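(* Let $G$ be a group of nilpotency class two generated by abelian subgroups $X$ and $Y$. Then $X$ and $Y$ are $\frac{1}{\sqrt2}$-orthogonal.
   Context: Two subgroups $X,Y$ with $G=\langle X,Y\rangle$ are $\varepsilon$-orthogonal if for every unitary representation $V$ of $G$ on a complex Hilbert space without nonzero $G$-invariant vectors one has $|\langle u,w\rangle|\le\varepsilon\|u\|\|w\|$ for all $u\in V^X$, $w\in V^Y$, where $V^H$ denotes the space of $H$-invariant vectors. $G$ is regarded as a discrete group. *)

theory Defs
  imports "HOL-Analysis.Analysis" "HOL-Algebra.Generated_Groups"
begin

section \<open>Complex Hilbert spaces\<close>

text \<open>
  The library has real inner product spaces only. A complex inner product space is added on top of
  its underlying real one, whose inner product is the real part of the complex one; so the norm of
  \<open>x\<close> is \<open>sqrt (Re (cinner x x))\<close>, and the library's topology and notion of completeness apply.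
  The complex inner product is linear in its first argument.
\<close>

class complex_inner = real_inner +
  fixes scaleC :: "complex \<Rightarrow> 'a \<Rightarrow> 'a" (infixr "*\<^sub>C" 75)
    and cinner :: "'a \<Rightarrow> 'a \<Rightarrow> complex"
  assumes scaleC_add_right: "a *\<^sub>C (x + y) = a *\<^sub>C x + a *\<^sub>C y"
    and scaleC_add_left: "(a + b) *\<^sub>C x = a *\<^sub>C x + b *\<^sub>C x"
    and scaleC_scaleC: "a *\<^sub>C b *\<^sub>C x = (a * b) *\<^sub>C x"
    and scaleC_of_real: "complex_of_real r *\<^sub>C x = r *\<^sub>R x"
    and cinner_commute: "cinner x y = cnj (cinner y x)"
    and cinner_add_left: "cinner (x + y) z = cinner x z + cinner y z"
    and cinner_scaleC_left: "cinner (a *\<^sub>C x) y = a * cinner x y"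
    and Re_cinner: "Re (cinner x y) = inner x y"

class chilbert_space = complex_inner + complete_space

instantiation complex :: chilbert_space
begin

definition scaleC_complex :: "complex \<Rightarrow> complex \<Rightarrow> complex" where
  "scaleC_complex a x = a * x"

definition cinner_complex :: "complex \<Rightarrow> complex \<Rightarrow> complex" where
  "cinner_complex x y = x * cnj y"

instance
  by standard
    (auto simp: scaleC_complex_def cinner_complex_def inner_complex_def algebra_simps
      scaleR_conv_of_real)

end


section \<open>Unitary representations of discrete groups\<close>

definition unitary_op :: "('v::chilbert_space \<Rightarrow> 'v) \<Rightarrow> bool" where
  "unitary_op U \<longleftrightarrow>
     (\<forall>x y. U (x + y) = U x + U y) \<and>
     (\<forall>a x. U (a *\<^sub>C x) = a *\<^sub>C U x) \<and>
     bij U \<and>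
     (\<forall>x y. cinner (U x) (U y) = cinner x y)"

definition unitary_group :: "('v::chilbert_space \<Rightarrow> 'v) monoid" where
  "unitary_group = \<lparr>carrier = {U. unitary_op U}, mult = (\<circ>), one = id\<rparr>"

definition unitary_rep ::
  "('g, 'm) monoid_scheme \<Rightarrow> ('g \<Rightarrow> 'v::chilbert_space \<Rightarrow> 'v) \<Rightarrow> bool" where
  "unitary_rep G \<pi> \<longleftrightarrow> \<pi> \<in> hom G unitary_group"

definition invariant_vectors :: "('g \<Rightarrow> 'v \<Rightarrow> 'v) \<Rightarrow> 'g set \<Rightarrow> 'v set" where
  "invariant_vectors \<pi> H = {v. \<forall>h\<in>H. \<pi> h v = v}"

text \<open>
  A definition cannot quantify over types, so the type of the Hilbert space is a parameter: \<open>X\<close> and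
  \<open>Y\<close> are \<open>\<epsilon>\<close>-orthogonal if \<open>eps_orthogonal TYPE('v) G X Y \<epsilon>\<close> holds for every type \<open>'v\<close> of class
  \<open>chilbert_space\<close>. It is meant for subgroups \<open>X\<close> and \<open>Y\<close> that generate \<open>G\<close>.
\<close>

definition eps_orthogonal ::
  "'v::chilbert_space itself \<Rightarrow> ('g, 'm) monoid_scheme \<Rightarrow> 'g set \<Rightarrow> 'g set \<Rightarrow> real \<Rightarrow> bool" where
  "eps_orthogonal _ G X Y \<epsilon> \<longleftrightarrow>
     (\<forall>\<pi> :: 'g \<Rightarrow> 'v \<Rightarrow> 'v.
        unitary_rep G \<pi> \<and> invariant_vectors \<pi> (carrier G) = {0} \<longrightarrow>
        (\<forall>u \<in> invariant_vectors \<pi> X. \<forall>w \<in> invariant_vectors \<pi> Y.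
           cmod (cinner u w) \<le> \<epsilon> * norm u * norm w))"


section \<open>Nilpotency class\<close>

definition commutator_subgroup ::
  "('g, 'm) monoid_scheme \<Rightarrow> 'g set \<Rightarrow> 'g set \<Rightarrow> 'g set" where
  "commutator_subgroup G H K =
     generate G {h \<otimes>\<^bsub>G\<^esub> k \<otimes>\<^bsub>G\<^esub> inv\<^bsub>G\<^esub> h \<otimes>\<^bsub>G\<^esub> inv\<^bsub>G\<^esub> k | h k. h \<in> H \<and> k \<in> K}"

text \<open>Indexing starts at 0: the \<open>n\<close>-th term is the one usually written \<open>\<gamma>\<close> with index \<open>n + 1\<close>.\<close>

primrec lower_central_series :: "('g, 'm) monoid_scheme \<Rightarrow> nat \<Rightarrow> 'g set" where
  "lower_central_series G 0 = carrier G"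
| "lower_central_series G (Suc n) = commutator_subgroup G (lower_central_series G n) (carrier G)"

definition nilpotent_group :: "('g, 'm) monoid_scheme \<Rightarrow> bool" where
  "nilpotent_group G \<longleftrightarrow> group G \<and> (\<exists>n. lower_central_series G n = {\<one>\<^bsub>G\<^esub>})"

definition nilpotency_class :: "('g, 'm) monoid_scheme \<Rightarrow> nat" where
  "nilpotency_class G = (LEAST n. lower_central_series G n = {\<one>\<^bsub>G\<^esub>})"

end

theory Submission
  imports Defs
begin

text \<open>
  Let \<open>u\<close> be \<open>X\<close>-invariant and \<open>w\<close> be \<open>Y\<close>-invariant. Suppose first that the centre of \<open>G\<close> acts by
  scalars, as in an irreducible representation, and that the commutator of some \<open>x \<in> X\<close> and
  \<open>y \<in> Y\<close>, which is central, acts by a scalar other than \<open>1\<close>. The vectors \<open>w\<close> and \<open>x w\<close> are then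
  eigenvectors of \<open>y\<close> for different eigenvalues, hence orthogonal. As \<open>u\<close> has
  the same inner product with both of them, \<open>2 \<bar>\<langle>u,w\<rangle>\<bar>\<^sup>2 \<le> \<parallel>u\<parallel>\<^sup>2 \<parallel>w\<parallel>\<^sup>2\<close>, which is the claim. If, on
  the other hand, all commutators of elements of \<open>X\<close> and \<open>Y\<close> act trivially, the projections onto the \<open>X\<close>- and the \<open>Y\<close>-invariant
  vectors commute, their product projects onto the \<open>G\<close>-invariant vectors, and so \<open>\<langle>u,w\<rangle> = 0\<close>.

  A decomposition into irreducibles is avoided by splitting along one commutator at a time. For a
  central \<open>z\<close>, the projection \<open>P z\<close> onto the \<open>z\<close>-invariant vectors preserves \<open>X\<close>- and
  \<open>Y\<close>-invariance. If \<open>z\<close> is the commutator of \<open>x\<close> and \<open>y\<close>, then \<open>w\<close> and \<open>x w\<close> are still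
  orthogonal when \<open>w\<close> is orthogonal to all \<open>z\<close>-invariant vectors
  (\<open>invariant_translate_orthogonal\<close>), so the bound holds on the range of \<open>1 - P z\<close>. By
  Cauchy-Schwarz, the bounds on orthogonal pieces add up to
  \<open>\<langle>u,w\<rangle> \<le> \<parallel>u\<parallel> \<parallel>w\<parallel> / \<surd>2 + \<langle>u, T w\<rangle>\<close> for each finite product \<open>T\<close> of such projections
  (\<open>inner_le_fold_proj\<close>).

  There may be infinitely many commutators, so a limit is needed. The right hand side is affine and
  continuous in \<open>T w\<close>; hence \<open>T w\<close> may be replaced by any point of the closed convex hull of all
  these vectors. The point \<open>p\<close> of least norm in it is fixed by every \<open>P z\<close>, because \<open>P z\<close> maps the
  hull to itself without increasing norms (\<open>common_fixed_point_in_hull\<close>). Thus all commutators fix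
  \<open>p\<close>, and \<open>\<langle>u,p\<rangle> = 0\<close> by the second case (\<open>orthogonal_on_commutator_invariants\<close>).

  Everything can be done over the reals, with the real part of the complex inner product: it gives
  the modulus once \<open>u\<close> has been multiplied by a suitable phase.
\<close>

section \<open>Nearest points in real Hilbert spaces\<close>

definition nearest_point :: "'v::{real_inner,complete_space} set \<Rightarrow> 'v \<Rightarrow> 'v" where
  "nearest_point S a = (SOME p. p \<in> S \<and> (\<forall>s\<in>S. dist a p \<le> dist a s))"

text \<open>
  By the parallelogram law, a sequence in \<open>S\<close> whose distances to \<open>a\<close> tend to the infimum is
  Cauchy: the midpoint of two of its members lies in \<open>S\<close>, so it is no closer to \<open>a\<close> than the
  infimum.
\<close>

lemma nearest_point_exists:
  fixes S :: "'v::{real_inner,complete_space} set"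
  assumes "closed S" "convex S" "S \<noteq> {}"
  shows "\<exists>p\<in>S. \<forall>s\<in>S. dist a p \<le> dist a s"
proof -
  define d where "d = infdist a S"
  have d_le: "d \<le> norm (s - a)" if "s \<in> S" for s
    using infdist_le[OF that, of a] by (simp add: d_def dist_norm norm_minus_commute)
  have d0: "d \<ge> 0" by (simp add: d_def infdist_nonneg)
  have "\<exists>s\<in>S. (norm (s - a))\<^sup>2 < d\<^sup>2 + 1 / real (Suc n)" for n
  proof -
    have "d < sqrt (d\<^sup>2 + 1 / real (Suc n))"
      by (rule real_less_rsqrt) simp
    then obtain s where "s \<in> S" "dist a s < sqrt (d\<^sup>2 + 1 / real (Suc n))"
      using cINF_less_iff[of S "dist a"] assms(3) by (auto simp: d_def infdist_def)
    then have "(dist a s)\<^sup>2 < (sqrt (d\<^sup>2 + 1 / real (Suc n)))\<^sup>2"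
      by (intro power_strict_mono) auto
    with \<open>s \<in> S\<close> show ?thesis
      by (auto simp: dist_norm norm_minus_commute intro!: bexI[of _ s] add_nonneg_nonneg)
  qed
  then obtain X where X: "\<And>n. X n \<in> S" "\<And>n. (norm (X n - a))\<^sup>2 < d\<^sup>2 + 1 / real (Suc n)"
    by metis
  have gap: "(norm (X m - X n))\<^sup>2 \<le> 2 / real (Suc m) + 2 / real (Suc n)" for m n
  proof -
    define c where "c = (1/2) *\<^sub>R X m + (1/2) *\<^sub>R X n"
    have "c \<in> S" unfolding c_def
      using convexD[OF assms(2) X(1) X(1), of "1/2" "1/2"] by simp
    then have "d\<^sup>2 \<le> (norm (c - a))\<^sup>2"
      using d_le d0 by (intro power_mono) auto
    moreover have "(norm (X m - X n))\<^sup>2 + 4 * (norm (c - a))\<^sup>2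
        = 2 * (norm (X m - a))\<^sup>2 + 2 * (norm (X n - a))\<^sup>2"
      by (simp add: c_def power2_norm_eq_inner inner_simps inner_commute algebra_simps)
    ultimately show ?thesis using X(2)[of m] X(2)[of n] by simp
  qed
  have "Cauchy X"
  proof (rule metric_CauchyI)
    fix e :: real assume "e > 0"
    obtain M :: nat where M: "4 / e\<^sup>2 < real M" using reals_Archimedean2 by blast
    have "dist (X m) (X n) < e" if "m \<ge> M" "n \<ge> M" for m n
    proof -
      have M0: "0 < real M" using M \<open>e > 0\<close>
        by (meson divide_nonneg_pos le_less_trans zero_le_numeral zero_less_power)
      have "1 / real (Suc m) \<le> 1 / real M" "1 / real (Suc n) \<le> 1 / real M"
        using that M0 by (auto intro!: divide_left_mono)
      then have "(norm (X m - X n))\<^sup>2 \<le> 4 / real M" using gap[of m n] by simp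
      also have "\<dots> < e\<^sup>2" using M M0 \<open>e > 0\<close> by (simp add: field_simps)
      finally show ?thesis
        using \<open>e > 0\<close> by (simp add: dist_norm power_less_imp_less_base)
    qed
    then show "\<exists>M. \<forall>m\<ge>M. \<forall>n\<ge>M. dist (X m) (X n) < e" by blast
  qed
  then obtain p where p: "X \<longlonglongrightarrow> p"
    using Cauchy_convergent convergent_def by blast
  have "p \<in> S" using closed_sequentially[OF assms(1) _ p] X(1) by blast
  have "(\<lambda>n. (norm (X n - a))\<^sup>2) \<longlonglongrightarrow> (norm (p - a))\<^sup>2"
    by (intro tendsto_intros p)
  moreover have "(\<lambda>n. d\<^sup>2 + 1 / real (Suc n)) \<longlonglongrightarrow> d\<^sup>2 + 0"
    using LIMSEQ_inverse_real_of_nat by (intro tendsto_intros) (simp add: inverse_eq_divide)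
  ultimately have "(norm (p - a))\<^sup>2 \<le> d\<^sup>2 + 0"
    by (rule LIMSEQ_le) (use X(2) in \<open>auto intro: less_imp_le\<close>)
  then have "(norm (p - a))\<^sup>2 \<le> d\<^sup>2" by simp
  then have "norm (p - a) \<le> d" using d0 by (rule power2_le_imp_le)
  then show ?thesis
    using \<open>p \<in> S\<close> d_le by (force simp: dist_norm norm_minus_commute)
qed

context
  fixes S :: "'v::{real_inner,complete_space} set"
  assumes S: "closed S" "convex S" "S \<noteq> {}"
begin

lemma nearest_point_in: "nearest_point S a \<in> S"
  and nearest_point_le: "s \<in> S \<Longrightarrow> dist a (nearest_point S a) \<le> dist a s"
  using someI_ex[OF nearest_point_exists[OF S, of a, unfolded Bex_def]]
  unfolding nearest_point_def by blast+

lemma nearest_point_unique: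
  assumes "p \<in> S" "\<And>s. s \<in> S \<Longrightarrow> dist a p \<le> dist a s"
  shows "p = nearest_point S a"
  using any_closest_point_unique[OF S(2,1) assms(1) nearest_point_in[of a]]
    assms(2) nearest_point_le by blast

text \<open>
  Uniqueness of the nearest point turns invariance of \<open>S\<close> under a nonexpansive map into a fixed
  point. It is applied to group elements, whose invariant vectors are thereby seen to be preserved
  by projections, and to projections acting on a convex hull.
\<close>

lemma nearest_point_fixed:
  assumes "f ` S \<subseteq> S" "f a = a" "\<And>x y. dist (f x) (f y) \<le> dist x y"
  shows "f (nearest_point S a) = nearest_point S a"
proof (rule nearest_point_unique)
  show "f (nearest_point S a) \<in> S" using assms(1) nearest_point_in by blast
  show "dist a (f (nearest_point S a)) \<le> dist a s" if "s \<in> S" for s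
    using assms(3)[of a "nearest_point S a"] nearest_point_le[OF that, of a] assms(2) by simp
qed

end

section \<open>Orthogonal projections\<close>

lemma subspace_convex_nonempty:
  fixes S :: "'v::real_vector set"
  assumes "subspace S"
  shows "convex S" "S \<noteq> {}"
  using assms subspace_imp_convex subspace_0 by auto

context
  fixes S :: "'v::{real_inner,complete_space} set"
  assumes cl: "closed S" and sub: "subspace S"
begin

private lemmas convex_nonempty = subspace_convex_nonempty[OF sub]

lemma projection_in: "nearest_point S a \<in> S"
  by (rule nearest_point_in[OF cl convex_nonempty])

lemma projection_orthogonal:
  assumes "s \<in> S"
  shows "inner (a - nearest_point S a) s = 0"
proof -
  let ?p = "nearest_point S a"
  have "inner (a - ?p) t \<le> 0" if "t \<in> S" for t
    using any_closest_point_dot[OF convex_nonempty(1) cl projection_in[of a], of "?p + t" a]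
      subspace_add[OF sub projection_in that] nearest_point_le[OF cl convex_nonempty]
    by auto
  from this[OF assms] this[OF subspace_neg[OF sub assms]] show ?thesis by simp
qed

lemma projection_unique:
  assumes "p \<in> S" "\<And>s. s \<in> S \<Longrightarrow> inner (a - p) s = 0"
  shows "nearest_point S a = p"
proof -
  let ?q = "nearest_point S a"
  have "?q - p \<in> S" by (intro subspace_diff[OF sub] projection_in assms(1))
  then have "inner (a - p) (?q - p) = 0" "inner (a - ?q) (?q - p) = 0"
    using assms(2) projection_orthogonal by blast+
  then have "inner (?q - p) (?q - p) = 0" by (simp add: inner_simps)
  then show ?thesis by simp
qed

lemma projection_pythagoras:
  "(norm a)\<^sup>2 = (norm (nearest_point S a))\<^sup>2 + (norm (a - nearest_point S a))\<^sup>2"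
  using projection_orthogonal[OF projection_in, of a a]
  by (simp add: power2_norm_eq_inner inner_simps inner_commute)

lemma norm_projection_le: "norm (nearest_point S a) \<le> norm a"
  using projection_pythagoras[of a] by (simp add: power2_le_imp_le)

lemma bounded_linear_projection: "bounded_linear (nearest_point S)"
proof (rule bounded_linear_intro[where K = 1])
  fix a b :: 'v and r :: real
  have "inner (a + b - (nearest_point S a + nearest_point S b)) s = 0" if "s \<in> S" for s
    using projection_orthogonal[OF that, of a] projection_orthogonal[OF that, of b]
    by (simp add: inner_simps)
  then show "nearest_point S (a + b) = nearest_point S a + nearest_point S b"
    by (intro projection_unique subspace_add[OF sub] projection_in)
  have "inner (r *\<^sub>R a - r *\<^sub>R nearest_point S a) s = 0" if "s \<in> S" for s
    using projection_orthogonal[OF that, of a]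
    by (simp flip: scaleR_diff_right)
  then show "nearest_point S (r *\<^sub>R a) = r *\<^sub>R nearest_point S a"
    by (intro projection_unique subspace_mul[OF sub] projection_in)
qed (simp add: norm_projection_le)

end

text \<open>
  The fixed point is the point of least norm in the hull: each \<open>f z\<close> is a contraction that maps the
  hull to itself, as applying it after \<open>fold f F\<close> amounts to appending \<open>z\<close> to \<open>F\<close>.
\<close>

lemma common_fixed_point_in_hull:
  fixes f :: "'z \<Rightarrow> 'v::{real_inner,complete_space} \<Rightarrow> 'v"
  assumes lin: "\<And>z. z \<in> C \<Longrightarrow> bounded_linear (f z)"
    and contr: "\<And>z v. z \<in> C \<Longrightarrow> norm (f z v) \<le> norm v"
  obtains p where "p \<in> closure (convex hull {fold f F w | F. set F \<subseteq> C})"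
    "\<And>z. z \<in> C \<Longrightarrow> f z p = p"
proof
  let ?O = "{fold f F w | F. set F \<subseteq> C}"
  let ?K = "closure (convex hull ?O)"
  have "fold f [] w \<in> ?O" by (intro CollectI exI[of _ "[]"]) simp
  then have K: "closed ?K" "convex ?K" "?K \<noteq> {}"
    by (auto simp: convex_closure)
  show "nearest_point ?K 0 \<in> ?K" by (rule nearest_point_in[OF K])
  show "f z (nearest_point ?K 0) = nearest_point ?K 0" if z: "z \<in> C" for z
  proof (rule nearest_point_fixed[OF K])
    interpret bounded_linear "f z" using lin[OF z] .
    have "f z ` ?O \<subseteq> ?O"
    proof safe
      fix F assume "set F \<subseteq> C"
      with z show "\<exists>F'. f z (fold f F w) = fold f F' w \<and> set F' \<subseteq> C"
        by (intro exI[of _ "F @ [z]"]) simp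
    qed
    then have "convex hull (f z ` ?O) \<subseteq> ?K"
      by (meson closure_subset hull_mono subset_trans)
    then have "f z ` (convex hull ?O) \<subseteq> ?K"
      by (simp add: convex_hull_linear_image[OF linear_axioms])
    then show "f z ` ?K \<subseteq> ?K"
      by (intro image_closure_subset linear_continuous_on lin[OF z]) auto
    show "f z 0 = 0" by (rule zero)
    show "dist (f z x) (f z y) \<le> dist x y" for x y
      using contr[OF z, of "x - y"] by (simp add: dist_norm diff)
  qed
qed

section \<open>Orthogonal representations\<close>

text \<open>
  A unitary representation is one of these for the underlying real Hilbert space. The projection
  onto the invariant vectors of a subset is the same in both readings, because these vectors form a
  complex subspace.
\<close>

locale orthogonal_representation = group G
  for G :: "('g, 'm) monoid_scheme" (structure) +
  fixes \<pi> :: "'g \<Rightarrow> 'v::{real_inner,complete_space} \<Rightarrow> 'v"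
  assumes linear_rep: "g \<in> carrier G \<Longrightarrow> linear (\<pi> g)"
    and inner_rep: "g \<in> carrier G \<Longrightarrow> inner (\<pi> g v) (\<pi> g w) = inner v w"
    and rep_mult: "g \<in> carrier G \<Longrightarrow> h \<in> carrier G \<Longrightarrow> \<pi> (g \<otimes> h) v = \<pi> g (\<pi> h v)"
    and rep_one: "\<pi> \<one> v = v"
begin

abbreviation "V \<equiv> invariant_vectors \<pi>"
abbreviation "proj H \<equiv> nearest_point (invariant_vectors \<pi> H)"

lemma norm_rep: "g \<in> carrier G \<Longrightarrow> norm (\<pi> g v) = norm v"
  by (simp add: norm_eq_sqrt_inner inner_rep)

lemma dist_rep: "g \<in> carrier G \<Longrightarrow> dist (\<pi> g v) (\<pi> g w) = dist v w"
  by (metis dist_norm norm_rep linear_diff linear_rep)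

lemma subspace_invariant_vectors: "H \<subseteq> carrier G \<Longrightarrow> subspace (V H)"
  by (auto simp: subspace_def invariant_vectors_def subset_iff linear_0 linear_add linear_scale
      linear_rep)

lemma closed_invariant_vectors:
  assumes "H \<subseteq> carrier G"
  shows "closed (V H)"
proof -
  have "continuous_on UNIV (\<pi> g)" if "g \<in> carrier G" for g
    unfolding continuous_on_iff using dist_rep[OF that] by auto
  then have "closed {v. \<pi> g v = v}" if "g \<in> H" for g
    using that assms by (intro closed_Collect_eq continuous_on_id) auto
  moreover have "V H = (\<Inter>g\<in>H. {v. \<pi> g v = v})" by (auto simp: invariant_vectors_def)
  ultimately show ?thesis by auto
qed

lemmas invariant_vectors_closed_subspace = closed_invariant_vectors subspace_invariant_vectors

lemma proj_invariant:
  assumes "H \<subseteq> carrier G" "K \<subseteq> carrier G" "\<And>g. g \<in> K \<Longrightarrow> \<pi> g ` V H \<subseteq> V H" "a \<in> V K"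
  shows "proj H a \<in> V K"
proof -
  have "\<pi> g (proj H a) = proj H a" if "g \<in> K" for g
  proof (rule nearest_point_fixed)
    show "closed (V H)" "convex (V H)" "V H \<noteq> {}"
      using closed_invariant_vectors subspace_convex_nonempty[OF subspace_invariant_vectors] assms(1) by auto
    show "dist (\<pi> g v) (\<pi> g w) \<le> dist v w" for v w
      using that assms(2) dist_rep by auto
  qed (use assms that in \<open>auto simp: invariant_vectors_def\<close>)
  then show ?thesis by (simp add: invariant_vectors_def)
qed

definition central :: "'g \<Rightarrow> bool" where
  "central z \<longleftrightarrow> z \<in> carrier G \<and> (\<forall>g\<in>carrier G. z \<otimes> g = g \<otimes> z)"

lemma central_rep_commute:
  assumes "central z" "g \<in> carrier G"
  shows "\<pi> z (\<pi> g v) = \<pi> g (\<pi> z v)"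
  using assms by (metis central_def rep_mult)

lemma central_preserves_invariant:
  assumes "central z" "H \<subseteq> carrier G"
  shows "\<pi> z ` V H \<subseteq> V H"
proof safe
  fix v assume "v \<in> V H"
  then have "\<pi> g (\<pi> z v) = \<pi> z v" if "g \<in> H" for g
    using central_rep_commute[OF assms(1), of g v] that assms(2)
    by (auto simp: invariant_vectors_def)
  then show "\<pi> z v \<in> V H" by (simp add: invariant_vectors_def)
qed

text \<open>
  A group element commutes with \<open>z\<close>, so it permutes the \<open>z\<close>-invariant vectors. If it also fixes
  \<open>a\<close>, it fixes the nearest of them.
\<close>

lemma proj_central_invariant:
  assumes "central z" "H \<subseteq> carrier G" "a \<in> V H"
  shows "proj {z} a \<in> V H"
proof (rule proj_invariant[OF _ assms(2) _ assms(3)])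
  show "{z} \<subseteq> carrier G" using assms(1) by (simp add: central_def)
  show "\<pi> g ` V {z} \<subseteq> V {z}" if "g \<in> H" for g
    using central_rep_commute[OF assms(1), of g] that assms(2)
    by (auto simp: invariant_vectors_def)
qed

text \<open>
  This replaces the argument with eigenvectors for different eigenvalues. Let \<open>s\<close> be the projection
  of \<open>x w\<close> onto the \<open>Y\<close>-invariant vectors. Moving \<open>y\<close> across the inner product shows that \<open>z s\<close> and
  \<open>s\<close> have the same inner product with \<open>x w\<close>, hence with \<open>s\<close>. As \<open>z s\<close> and \<open>s\<close> have the same
  norm, this forces \<open>z s = s\<close>, and \<open>w\<close>, being \<open>Y\<close>-invariant, satisfies \<open>\<langle>w, x w\<rangle> = \<langle>w, s\<rangle> = 0\<close>.
\<close>

lemma invariant_translate_orthogonal: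
  assumes Y: "subgroup Y G" and x: "x \<in> carrier G" and y: "y \<in> Y"
    and z: "central z" and comm: "x \<otimes> y = z \<otimes> (y \<otimes> x)"
    and w: "w \<in> V Y" and w_perp: "\<And>v. v \<in> V {z} \<Longrightarrow> inner w v = 0"
  shows "inner w (\<pi> x w) = 0"
proof -
  note YG = subgroup.subset[OF Y]
  have yG: "y \<in> carrier G" and zG: "z \<in> carrier G"
    using y YG z by (auto simp: central_def)
  define s where "s = proj Y (\<pi> x w)"
  have sY: "s \<in> V Y" unfolding s_def by (intro projection_in invariant_vectors_closed_subspace YG)
  have proj_s: "inner v s = inner v (\<pi> x w)" if "v \<in> V Y" for v
    using projection_orthogonal[OF closed_invariant_vectors[OF YG] subspace_invariant_vectors[OF YG] that, of "\<pi> x w"]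
    by (simp add: s_def inner_diff_left inner_commute[of v])
  have zs: "\<pi> z s \<in> V Y" using central_preserves_invariant[OF z YG] sY by blast
  have fixed: "\<pi> y w = w" "\<pi> y s = s" using w sY y by (auto simp: invariant_vectors_def)
  have "inner (\<pi> z s) s = inner (\<pi> z s) (\<pi> x (\<pi> y w))"
    using proj_s[OF zs] fixed by simp
  also have "\<pi> x (\<pi> y w) = \<pi> z (\<pi> y (\<pi> x w))"
    using arg_cong[OF comm, of "\<lambda>g. \<pi> g w"] x yG zG by (simp add: rep_mult)
  also have "inner (\<pi> z s) \<dots> = inner (\<pi> y s) (\<pi> y (\<pi> x w))"
    using zG fixed by (simp add: inner_rep)
  also have "\<dots> = inner s s" using yG proj_s[OF sY] by (simp add: inner_rep)
  finally have "inner (\<pi> z s) s = inner s s" .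
  moreover have "inner (\<pi> z s) (\<pi> z s) = inner s s" using zG by (simp add: inner_rep)
  ultimately have "inner (\<pi> z s - s) (\<pi> z s - s) = 0"
    by (simp add: inner_simps inner_commute)
  then have "s \<in> V {z}" by (simp add: invariant_vectors_def)
  then show ?thesis using w_perp proj_s[OF w] by simp
qed

text \<open>
  As \<open>x\<close> fixes \<open>u\<close>, twice \<open>\<langle>u,w\<rangle>\<close> is the inner product of \<open>u\<close> with \<open>w + x w\<close>, a sum of two orthogonal
  vectors of the same length.
\<close>

lemma inner_le_orthogonal_to_invariants:
  assumes Y: "subgroup Y G" and x: "x \<in> carrier G" and y: "y \<in> Y"
    and z: "central z" and comm: "x \<otimes> y = z \<otimes> (y \<otimes> x)"
    and u: "\<pi> x u = u"
    and w: "w \<in> V Y" and w_perp: "\<And>v. v \<in> V {z} \<Longrightarrow> inner w v = 0"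
  shows "inner u w \<le> 1 / sqrt 2 * norm u * norm w"
proof -
  have "2 * inner u w = inner u (w + \<pi> x w)"
    using inner_rep[OF x, of u w] u by (simp add: inner_simps)
  also have "\<dots> \<le> norm u * norm (w + \<pi> x w)" by (rule norm_cauchy_schwarz)
  also have "(norm (w + \<pi> x w))\<^sup>2 = 2 * (norm w)\<^sup>2"
    using invariant_translate_orthogonal[OF assms(1-5,7,8)] inner_rep[OF x, of w w]
    by (simp add: power2_norm_eq_inner inner_simps inner_commute)
  then have "norm (w + \<pi> x w) = sqrt 2 * norm w"
    by (metis norm_ge_zero real_sqrt_mult real_sqrt_unique)
  finally have "2 * inner u w \<le> sqrt 2 * (norm u * norm w)" by (simp add: ac_simps)
  then have "inner u w \<le> (sqrt 2 / 2) * (norm u * norm w)" by simp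
  also have "sqrt 2 / 2 = 1 / sqrt 2" by (simp add: real_divide_square_eq field_simps)
  finally show ?thesis by (simp add: ac_simps)
qed

definition central_commutator :: "'g \<Rightarrow> 'g set \<Rightarrow> 'g set \<Rightarrow> bool" where
  "central_commutator z X Y \<longleftrightarrow> central z \<and> (\<exists>x\<in>X. \<exists>y\<in>Y. x \<otimes> y = z \<otimes> (y \<otimes> x))"

lemma fold_proj_invariant:
  assumes "\<And>z. z \<in> set F \<Longrightarrow> central z" "H \<subseteq> carrier G" "w \<in> V H"
  shows "fold (\<lambda>z. proj {z}) F w \<in> V H"
  using assms(1,3) by (induction F arbitrary: w) (auto intro: proj_central_invariant[OF _ assms(2)])

text \<open>
  By induction on \<open>F\<close>, with \<open>u\<close> and \<open>w\<close> varying. Splitting along the first \<open>z\<close> gives pairs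
  \<open>(u0, w0)\<close> of \<open>z\<close>-invariant vectors and \<open>(u1, w1)\<close> of vectors orthogonal to these. The second pair
  satisfies the bound outright and the induction hypothesis treats the first; the constant does not
  grow because \<open>\<parallel>u0\<parallel> \<parallel>w0\<parallel> + \<parallel>u1\<parallel> \<parallel>w1\<parallel> \<le> \<parallel>u\<parallel> \<parallel>w\<parallel>\<close>.
\<close>

lemma inner_le_fold_proj:
  assumes X: "subgroup X G" and Y: "subgroup Y G"
    and F: "\<And>z. z \<in> set F \<Longrightarrow> central_commutator z X Y"
    and "u \<in> V X" "w \<in> V Y"
  shows "inner u w \<le> 1 / sqrt 2 * norm u * norm w + inner u (fold (\<lambda>z. proj {z}) F w)"
  using assms(3-5)
proof (induction F arbitrary: u w)
  case Nil
  then show ?case by simp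
next
  case (Cons z F)
  note XG = subgroup.subset[OF X] and YG = subgroup.subset[OF Y]
  have central: "central t" if "t \<in> set (z # F)" for t
    using Cons.prems(1)[OF that] by (simp add: central_commutator_def)
  then have zC: "central z" and zG: "{z} \<subseteq> carrier G" by (auto simp: central_def)
  obtain x y where xy: "x \<in> X" "y \<in> Y" "x \<otimes> y = z \<otimes> (y \<otimes> x)"
    using Cons.prems(1)[of z] by (auto simp: central_commutator_def)
  note perp = projection_orthogonal[OF closed_invariant_vectors[OF zG] subspace_invariant_vectors[OF zG]]
  define u0 w0 where "u0 = proj {z} u" and "w0 = proj {z} w"
  define u1 w1 where "u1 = u - u0" and "w1 = w - w0"
  have 0: "u0 \<in> V X" "w0 \<in> V Y" "w0 \<in> V {z}"
    unfolding u0_def w0_def using Cons.prems zG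
    by (auto intro!: proj_central_invariant[OF zC] XG YG projection_in
        invariant_vectors_closed_subspace)
  then have 1: "u1 \<in> V X" "w1 \<in> V Y"
    unfolding u1_def w1_def using Cons.prems XG YG
    by (auto intro!: subspace_diff subspace_invariant_vectors)
  have perp_u: "inner u1 v = 0" and perp_w: "inner w1 v = 0" if "v \<in> V {z}" for v
    using perp[OF that] by (auto simp: u0_def w0_def u1_def w1_def)
  \<comment> \<open>The remaining projections keep \<open>w0\<close> invariant under \<open>z\<close>, so \<open>u1\<close> does not see the result and
    \<open>u0\<close> may be replaced by \<open>u\<close> in the last term.\<close>
  have fold_z: "fold (\<lambda>z. proj {z}) F w0 \<in> V {z}"
    using 0(3) zG central by (intro fold_proj_invariant) auto
  have "u0 \<in> V {z}" unfolding u0_def using zG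
    by (intro projection_in invariant_vectors_closed_subspace)
  have "inner u w = inner u0 w0 + inner u1 w1"
    using perp_u[OF 0(3)] perp_w[OF \<open>u0 \<in> V {z}\<close>]
    by (simp add: u1_def w1_def inner_simps inner_commute)
  also have "inner u1 w1 \<le> 1 / sqrt 2 * norm u1 * norm w1"
    using xy 1 perp_w XG
    by (intro inner_le_orthogonal_to_invariants[OF Y _ _ zC, of x y]) (auto simp: invariant_vectors_def)
  also have "inner u0 w0 \<le> 1 / sqrt 2 * norm u0 * norm w0 + inner u0 (fold (\<lambda>z. proj {z}) F w0)"
    using Cons.prems(1) by (intro Cons.IH 0) auto
  also have "inner u0 (fold (\<lambda>z. proj {z}) F w0) = inner u (fold (\<lambda>z. proj {z}) F w0)"
    using perp_u[OF fold_z] by (simp add: u1_def inner_diff_left)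
  finally have "inner u w \<le> 1 / sqrt 2 * (norm u0 * norm w0 + norm u1 * norm w1)
      + inner u (fold (\<lambda>z. proj {z}) F w0)"
    by (simp add: algebra_simps)
  moreover have "norm u0 * norm w0 + norm u1 * norm w1 \<le> norm u * norm w"
  proof (rule power2_le_imp_le)
    have "(norm u)\<^sup>2 = (norm u0)\<^sup>2 + (norm u1)\<^sup>2" "(norm w)\<^sup>2 = (norm w0)\<^sup>2 + (norm w1)\<^sup>2"
      unfolding u1_def w1_def u0_def w0_def
      by (intro projection_pythagoras closed_invariant_vectors subspace_invariant_vectors zG)+
    \<comment> \<open>Lagrange's identity in the plane\<close>
    then have "(norm u * norm w)\<^sup>2 = (norm u0 * norm w0 + norm u1 * norm w1)\<^sup>2
        + (norm u0 * norm w1 - norm u1 * norm w0)\<^sup>2"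
      by (simp add: power_mult_distrib) (simp add: power2_eq_square algebra_simps)
    then show "(norm u0 * norm w0 + norm u1 * norm w1)\<^sup>2 \<le> (norm u * norm w)\<^sup>2" by simp
  qed simp
  ultimately have "inner u w \<le> 1 / sqrt 2 * (norm u * norm w) + inner u (fold (\<lambda>z. proj {z}) F w0)"
    by (smt (verit) mult_left_mono divide_nonneg_nonneg real_sqrt_ge_zero)
  then show ?case by (simp add: w0_def mult.assoc)
qed

text \<open>
  The projection \<open>q\<close> of \<open>p\<close> onto the \<open>X\<close>-invariant vectors is fixed by all of \<open>G\<close>, hence zero. For
  this, let \<open>y \<in> Y\<close>. The commutators fix \<open>p\<close>, and therefore \<open>q\<close>, so \<open>x y q = y x q = y q\<close> for
  \<open>x \<in> X\<close>: the vector \<open>y q\<close> is again \<open>X\<close>-invariant. It is as close to \<open>p = y p\<close> as \<open>q\<close> is, so it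
  equals \<open>q\<close>.
\<close>

lemma orthogonal_on_commutator_invariants:
  assumes X: "subgroup X G" and Y: "subgroup Y G" and gen: "generate G (X \<union> Y) = carrier G"
    and no_inv: "V (carrier G) = {0}"
    and comm: "\<And>x y. x \<in> X \<Longrightarrow> y \<in> Y \<Longrightarrow> \<exists>z. central z \<and> p \<in> V {z} \<and> x \<otimes> y = z \<otimes> (y \<otimes> x)"
    and u: "u \<in> V X" and p: "p \<in> V Y"
  shows "inner u p = 0"
proof -
  note XG = subgroup.subset[OF X] and YG = subgroup.subset[OF Y]
  define q where "q = proj X p"
  have qX: "q \<in> V X" unfolding q_def by (intro projection_in invariant_vectors_closed_subspace XG)
  have "\<pi> y q = q" if y: "y \<in> Y" for y
  proof -
    have yG: "y \<in> carrier G" using y YG by blast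
    have "\<pi> y q \<in> V X"
      unfolding invariant_vectors_def
    proof safe
      fix x assume x: "x \<in> X"
      then have xG: "x \<in> carrier G" using XG by blast
      obtain z where z: "central z" "p \<in> V {z}" "x \<otimes> y = z \<otimes> (y \<otimes> x)" using comm[OF x y] by blast
      then have zG: "z \<in> carrier G" by (simp add: central_def)
      have "q \<in> V {z}" unfolding q_def
        using zG z(2) central_preserves_invariant[OF z(1) XG] by (intro proj_invariant XG) auto
      then have "\<pi> z q = q" by (simp add: invariant_vectors_def)
      have "\<pi> x (\<pi> y q) = \<pi> (x \<otimes> y) q" using xG yG by (simp add: rep_mult)
      also have "\<dots> = \<pi> z (\<pi> y (\<pi> x q))" using xG yG zG by (simp add: z(3) rep_mult)
      also have "\<dots> = \<pi> y (\<pi> z q)"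
        using qX x central_rep_commute[OF z(1) yG] by (simp add: invariant_vectors_def)
      finally show "\<pi> x (\<pi> y q) = \<pi> y q" using \<open>\<pi> z q = q\<close> by simp
    qed
    moreover have "dist p (\<pi> y q) \<le> dist p s" if "s \<in> V X" for s
    proof -
      have "dist p (\<pi> y q) = dist p q"
        using dist_rep[OF yG, of p q] p y by (simp add: invariant_vectors_def)
      also have "\<dots> \<le> dist p s" unfolding q_def
        by (intro nearest_point_le closed_invariant_vectors subspace_convex_nonempty
            subspace_invariant_vectors XG that)
      finally show ?thesis .
    qed
    ultimately show ?thesis unfolding q_def
      by (intro nearest_point_unique closed_invariant_vectors subspace_convex_nonempty
            subspace_invariant_vectors XG)
  qed
  then have XY: "\<pi> h q = q" if "h \<in> X \<union> Y" for h
    using qX that by (auto simp: invariant_vectors_def)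
  have "\<pi> g q = q" if "g \<in> generate G (X \<union> Y)" for g
    using that
  proof induction
    case one
    then show ?case by (rule rep_one)
  next
    case (inv h)
    then have "inv h \<in> X \<union> Y" using X Y by (auto intro: subgroup.m_inv_closed)
    then show ?case by (rule XY)
  next
    case (eng g h)
    then have "g \<in> carrier G" "h \<in> carrier G" using gen by auto
    with eng show ?case by (simp add: rep_mult)
  qed (rule XY)
  then have "q \<in> V (carrier G)" using gen by (simp add: invariant_vectors_def)
  then have "q = 0" using no_inv by simp
  then show ?thesis
    using projection_orthogonal[OF closed_invariant_vectors[OF XG] subspace_invariant_vectors[OF XG] u, of p]
    by (simp add: q_def inner_commute)
qed

text \<open>
  The bound for finite products of projections passes to the closed convex hull of the vectors that
  they make out of \<open>w\<close>. At the common fixed point \<open>p\<close> in this hull its error term \<open>\<langle>u,p\<rangle>\<close> vanishes.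
\<close>

lemma inner_invariant_vectors_le:
  assumes X: "subgroup X G" and Y: "subgroup Y G" and gen: "generate G (X \<union> Y) = carrier G"
    and no_inv: "V (carrier G) = {0}"
    and comm: "\<And>x y. x \<in> X \<Longrightarrow> y \<in> Y \<Longrightarrow> \<exists>z. central z \<and> x \<otimes> y = z \<otimes> (y \<otimes> x)"
    and u: "u \<in> V X" and w: "w \<in> V Y"
  shows "inner u w \<le> 1 / sqrt 2 * norm u * norm w"
proof -
  note XG = subgroup.subset[OF X] and YG = subgroup.subset[OF Y]
  define C where "C = {z. central_commutator z X Y}"
  have central: "central z" if "z \<in> C" for z using that by (simp add: C_def central_commutator_def)
  define K where "K = closure (convex hull {fold (\<lambda>z. proj {z}) F w | F. set F \<subseteq> C})"
  have bl: "bounded_linear (proj {z})" and nle: "norm (proj {z} v) \<le> norm v"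
    and pin: "proj {z} v \<in> V {z}" if "z \<in> C" for z v
    using central[OF that]
    by (auto intro!: bounded_linear_projection norm_projection_le projection_in
        invariant_vectors_closed_subspace simp: central_def)
  obtain p where p: "p \<in> K" "\<And>z. z \<in> C \<Longrightarrow> proj {z} p = p"
    using common_fixed_point_in_hull[of C "\<lambda>z. proj {z}" w] bl nle unfolding K_def by blast
  have "K \<subseteq> V Y" unfolding K_def
    using fold_proj_invariant[OF central YG w]
    by (intro closure_minimal hull_minimal closed_invariant_vectors YG
        subspace_convex_nonempty(1)[OF subspace_invariant_vectors]) auto
  moreover have "K \<subseteq> {k. inner u k \<ge> inner u w - 1 / sqrt 2 * norm u * norm w}" unfolding K_def
    using inner_le_fold_proj[OF X Y _ u w]
    by (intro closure_minimal hull_minimal closed_halfspace_ge convex_halfspace_ge)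
      (auto simp: C_def subset_iff algebra_simps)
  moreover have "inner u p = 0"
  proof (rule orthogonal_on_commutator_invariants[OF X Y gen no_inv _ u])
    show "p \<in> V Y" using calculation(1) p(1) by blast
    fix x y assume xy: "x \<in> X" "y \<in> Y"
    then obtain z where z: "central z" "x \<otimes> y = z \<otimes> (y \<otimes> x)" using comm by blast
    with xy have "z \<in> C" by (auto simp: C_def central_commutator_def)
    with pin[of z p] p(2) z show "\<exists>z. central z \<and> p \<in> V {z} \<and> x \<otimes> y = z \<otimes> (y \<otimes> x)" by force
  qed
  ultimately show ?thesis using p(1) by auto
qed

end

section \<open>Groups of class two and their unitary representations\<close>

text \<open>
  Commutators lie in the second term of the lower central series, so their own commutators with
  group elements lie in the third term, which is trivial.
\<close>

lemma (in group) class_two_commutator: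
  assumes "nilpotent_group G" "nilpotency_class G = 2" "x \<in> carrier G" "y \<in> carrier G"
  defines "z \<equiv> x \<otimes> y \<otimes> inv x \<otimes> inv y"
  shows "z \<in> carrier G" "\<And>g. g \<in> carrier G \<Longrightarrow> z \<otimes> g = g \<otimes> z" "x \<otimes> y = z \<otimes> (y \<otimes> x)"
proof -
  show zG: "z \<in> carrier G" using assms(3,4) by (simp add: z_def)
  have lcs: "lower_central_series G 2 = {\<one>}"
    using assms(1,2) LeastI_ex[of "\<lambda>n. lower_central_series G n = {\<one>}"]
    unfolding nilpotent_group_def nilpotency_class_def by metis
  have "z \<in> lower_central_series G 1"
    unfolding z_def using assms(3,4)
    by (auto simp: commutator_subgroup_def intro!: generate.incl)
  show "z \<otimes> g = g \<otimes> z" if g: "g \<in> carrier G" for g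
  proof -
    have "z \<otimes> g \<otimes> inv z \<otimes> inv g \<in> lower_central_series G 2"
      using g \<open>z \<in> lower_central_series G 1\<close>
      by (auto simp: commutator_subgroup_def numeral_2_eq_2 intro!: generate.incl)
    then have "z \<otimes> g \<otimes> inv z \<otimes> inv g = \<one>" using lcs by simp
    then have "z \<otimes> g \<otimes> inv (g \<otimes> z) = \<one>" using g zG by (simp add: inv_mult_group m_assoc)
    then show ?thesis using g zG by (metis inv_equality inv_inv inv_closed m_closed)
  qed
  have "z \<otimes> (y \<otimes> x) = x \<otimes> (y \<otimes> (inv x \<otimes> (inv y \<otimes> (y \<otimes> x))))"
    using assms(3,4) by (simp add: z_def m_assoc)
  also have "inv y \<otimes> (y \<otimes> x) = x" using assms(3,4) by (simp flip: m_assoc)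
  finally show "x \<otimes> y = z \<otimes> (y \<otimes> x)" using assms(3,4) by simp
qed

lemma (in group) orthogonal_representation_of_unitary_rep:
  fixes \<pi> :: "'a \<Rightarrow> 'v::chilbert_space \<Rightarrow> 'v"
  assumes "unitary_rep G \<pi>"
  shows "orthogonal_representation G \<pi>"
proof (intro orthogonal_representation.intro orthogonal_representation_axioms.intro)
  show "group G" by (rule is_group)
  have U: "unitary_op (\<pi> g)" if "g \<in> carrier G" for g
    using assms that by (auto simp: unitary_rep_def hom_def unitary_group_def)
  show mult: "\<pi> (g \<otimes> h) v = \<pi> g (\<pi> h v)" if "g \<in> carrier G" "h \<in> carrier G" for g h v
    using assms that by (auto simp: unitary_rep_def hom_def unitary_group_def)
  show "linear (\<pi> g)" if "g \<in> carrier G" for g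
    using U[OF that] unfolding unitary_op_def by (intro linearI) (auto simp flip: scaleC_of_real)
  show "inner (\<pi> g v) (\<pi> g w) = inner v w" if "g \<in> carrier G" for g v w
    using U[OF that] unfolding unitary_op_def by (simp flip: Re_cinner)
  have "\<pi> \<one> (\<pi> \<one> v) = \<pi> \<one> v" for v using mult[of \<one> \<one> v] by simp
  moreover have "inj (\<pi> \<one>)" using U[OF one_closed] by (simp add: unitary_op_def bij_def)
  ultimately show "\<pi> \<one> v = v" for v by (simp add: inj_eq)
qed

theorem proposition4p8:
  fixes G :: "('g, 'm) monoid_scheme" and X Y :: "'g set"
  assumes "group G"
    and "nilpotent_group G" and "nilpotency_class G = 2"
    and "subgroup X G" and "comm_group (G\<lparr>carrier := X\<rparr>)"
    and "subgroup Y G" and "comm_group (G\<lparr>carrier := Y\<rparr>)"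
    and "generate G (X \<union> Y) = carrier G"
  shows "eps_orthogonal TYPE('v::chilbert_space) G X Y (1 / sqrt 2)"
  unfolding eps_orthogonal_def
proof (intro allI impI ballI, elim conjE)
  fix \<pi> :: "'g \<Rightarrow> 'v \<Rightarrow> 'v" and u w
  assume rep: "unitary_rep G \<pi>" and no_inv: "invariant_vectors \<pi> (carrier G) = {0}"
    and u: "u \<in> invariant_vectors \<pi> X" and w: "w \<in> invariant_vectors \<pi> Y"
  interpret group G by fact
  interpret orthogonal_representation G \<pi>
    using rep by (rule orthogonal_representation_of_unitary_rep)
  \<comment> \<open>The phase that makes the inner product real and nonnegative; it is \<open>0\<close> if \<open>u\<close> and \<open>w\<close> are
    orthogonal, so that \<open>a u\<close> may be shorter than \<open>u\<close>.\<close>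
  define a where "a = cnj (sgn (cinner u w))"
  have "a *\<^sub>C u \<in> invariant_vectors \<pi> X"
  proof -
    have "unitary_op (\<pi> g)" if "g \<in> X" for g
      using rep that subgroup.subset[OF assms(4)]
      by (auto simp: unitary_rep_def hom_def unitary_group_def)
    then show ?thesis using u by (simp add: invariant_vectors_def unitary_op_def)
  qed
  moreover have "\<exists>z. central z \<and> x \<otimes>\<^bsub>G\<^esub> y = z \<otimes>\<^bsub>G\<^esub> (y \<otimes>\<^bsub>G\<^esub> x)" if "x \<in> X" "y \<in> Y" for x y
    unfolding central_def
    using class_two_commutator[OF assms(2,3), of x y] that
      subgroup.subset[OF assms(4)] subgroup.subset[OF assms(6)] by blast
  ultimately have "inner (a *\<^sub>C u) w \<le> 1 / sqrt 2 * norm (a *\<^sub>C u) * norm w"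
    using w by (intro inner_invariant_vectors_le[OF assms(4,6,8) no_inv])
  moreover have "inner (a *\<^sub>C u) w = cmod (cinner u w)"
  proof -
    have "cnj (sgn c) * c = complex_of_real (cmod c)" for c
    proof -
      have "cnj (sgn c) * c = cnj c * c / complex_of_real (cmod c)" by (simp add: sgn_eq)
      also have "cnj c * c = (complex_of_real (cmod c))\<^sup>2"
        by (metis complex_norm_square mult.commute of_real_power)
      finally show ?thesis by (simp add: power2_eq_square)
    qed
    then show ?thesis
      by (simp add: a_def cinner_scaleC_left flip: Re_cinner)
  qed
  moreover have "norm (a *\<^sub>C u) \<le> norm u"
  proof -
    have "cinner u (a *\<^sub>C u) = cnj a * cinner u u"
      by (metis cinner_commute cinner_scaleC_left complex_cnj_mult)
    then have "cinner (a *\<^sub>C u) (a *\<^sub>C u) = complex_of_real ((cmod a)\<^sup>2) * cinner u u"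
      by (simp only: cinner_scaleC_left complex_norm_square mult.assoc)
    then have "inner (a *\<^sub>C u) (a *\<^sub>C u) = (cmod a)\<^sup>2 * inner u u"
      by (simp only: Re_cinner[symmetric] Re_complex_of_real times_complex.sel
          Im_complex_of_real mult_zero_left diff_zero)
    then have "(norm (a *\<^sub>C u))\<^sup>2 = (cmod a * norm u)\<^sup>2"
      by (simp only: power2_norm_eq_inner[of u] power2_norm_eq_inner[of "a *\<^sub>C u"] power_mult_distrib)
    moreover have "cmod a \<le> 1" by (simp add: a_def norm_sgn)
    ultimately show ?thesis
      by (simp add: power2_eq_iff_nonneg mult_left_le_one_le)
  qed
  ultimately show "cmod (cinner u w) \<le> 1 / sqrt 2 * norm u * norm w"
    by (smt (verit) mult_left_mono mult_right_mono norm_ge_zero divide_nonneg_nonneg real_sqrt_ge_zero)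
qed

end
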